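(* Let $q$ be a prime power, $s$ a positive integer and $n=\frac{q^{2s}-1}{q+1}$. Then the second largest $q$-cyclotomic coset leader modulo $n$ is $$\delta_{2,n}=\begin{cases}\dfrac{(q-1)q^{2s-1}-q^{s+1}-1}{q+1}, & \text{if } 2\nmid s \text{ and } s>4,\\[2mm] \dfrac{(q-1)q^{2s-1}-q^{s+2}-1}{q+1}, & \text{if } 2\mid s \text{ and } s>6,\end{cases}$$ and in these cases $|C_{\delta_{2,n}}|=2s$.
   Context: For $0\le t\le n-1$, the $q$-cyclotomic coset of $t$ modulo $n$ is $C_t=\{tq^j\bmod n: j\ge 0\}\subseteq\{0,\dots,n-1\}$; its smallest element is its coset leader. $\delta_{2,n}$ denotes the second largest element of the set of all $q$-cyclotomic coset leaders modulo $n$. *)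

theory Defs
  imports Complex_Main "HOL-Number_Theory.Prime_Powers"
begin

definition cyclotomic_coset :: "nat \<Rightarrow> nat \<Rightarrow> nat \<Rightarrow> nat set" where
  "cyclotomic_coset q n t = {t * q ^ j mod n | j :: nat. True}"

definition coset_leader :: "nat \<Rightarrow> nat \<Rightarrow> nat \<Rightarrow> nat" where
  "coset_leader q n t = Min (cyclotomic_coset q n t)"

definition coset_leaders :: "nat \<Rightarrow> nat \<Rightarrow> nat set" where
  "coset_leaders q n = coset_leader q n ` {0..<n}"

(* Only meaningful for finite sets with at least two elements. *)
definition second_largest :: "nat set \<Rightarrow> nat" where
  "second_largest S = Max (S - {Max S})"

definition delta2 :: "nat \<Rightarrow> nat \<Rightarrow> nat" where
  "delta2 q n = second_largest (coset_leaders q n)"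

lemma cyclotomic_coset_subset: "n > 0 \<Longrightarrow> cyclotomic_coset q n t \<subseteq> {0..<n}"
  unfolding cyclotomic_coset_def by auto

lemma finite_cyclotomic_coset: "n > 0 \<Longrightarrow> finite (cyclotomic_coset q n t)"
  by (rule finite_subset [OF cyclotomic_coset_subset finite_atLeastLessThan])

lemma finite_coset_leaders: "finite (coset_leaders q n)"
  by (simp add: coset_leaders_def)

(* The natural-number division in the definition of the modulus is exact. *)
lemma Suc_dvd_power_even_minus_1:
  fixes q s :: nat
  shows "(q + 1) dvd (q ^ (2 * s) - 1)"
proof (cases "q = 0")
  case True
  then show ?thesis
    by (cases "s = 0") (simp_all add: power_0_left)
next
  case False
  have "int q ^ 2 - 1 = (int q + 1) * (int q - 1)"
    by (simp add: power2_eq_square algebra_simps)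
  then have "(int q + 1) dvd (int q ^ 2 - 1)"
    by (simp only: dvd_triv_left)
  moreover have "(int q ^ 2 - 1) dvd ((int q ^ 2) ^ s - 1)"
    by (simp only: power_diff_1_eq dvd_triv_left)
  ultimately have "(int q + 1) dvd ((int q ^ 2) ^ s - 1)"
    by (rule dvd_trans)
  then have "(int q + 1) dvd (int q ^ (2 * s) - 1)"
    by (simp only: power_mult)
  moreover have "int (q ^ (2 * s) - 1) = int q ^ (2 * s) - 1"
  proof -
    have "1 \<le> q ^ (2 * s)"
      using False by (intro one_le_power) linarith
    then show ?thesis
      by (simp only: of_nat_diff of_nat_power of_nat_1)
  qed
  ultimately have "int (q + 1) dvd int (q ^ (2 * s) - 1)"
    by (simp only: of_nat_add of_nat_1)
  then show ?thesis
    by (simp only: of_nat_dvd_iff)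
qed

end

theory Submission
  imports Defs "HOL-Number_Theory.Cong"
begin

text \<open>
  Put \<open>N = q ^ (2 * s) - 1 = (q + 1) * n\<close> and pass from \<open>t < n\<close> to \<open>U = N - (q + 1) * t\<close>.
  Multiplying \<open>t\<close> by \<open>q\<close> modulo \<open>n\<close> rotates the base-\<open>q\<close> word of length \<open>2 * s\<close> of \<open>U\<close>, so the
  nonzero coset leaders are given by the words divisible by \<open>q + 1\<close> that dominate all their
  rotations, and large leaders are small words. If such a word lies below
  \<open>q ^ (2 * s - 1) + q ^ e\<close>, every nonzero digit equals 1 and is followed by a run of zeros so
  long that there is no room for three ones when \<open>3 * e < 4 * s\<close>. A single one is excluded by
  divisibility by \<open>q + 1\<close>, which also forces the cyclic distance of two ones to be odd. Hence the
  smallest words are \<open>q ^ (2 * s - 1) + q ^ (e - 2)\<close> and \<open>q ^ (2 * s - 1) + q ^ e\<close>, where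
  \<open>e\<close> is the even one of \<open>s + 1\<close> and \<open>s + 2\<close>.
\<close>

section \<open>Coset leaders and coset sizes for an arbitrary modulus\<close>

text \<open>A coset contains the coset of each of its elements, so its minimum lies below all its
  own shifts. Conversely, \<open>t\<close> belongs to its own coset through
  \<open>j = 0\<close>.\<close>

lemma coset_leaders_eq:
  assumes "n > 0"
  shows "coset_leaders q n = {t. t < n \<and> (\<forall>j. t \<le> t * q ^ j mod n)}"
proof (intro set_eqI iffI)
  fix l assume "l \<in> coset_leaders q n"
  then obtain t where "t < n" and l: "l = Min (cyclotomic_coset q n t)"
    by (auto simp: coset_leaders_def coset_leader_def)
  have ne: "cyclotomic_coset q n t \<noteq> {}"
    by (auto simp: cyclotomic_coset_def)
  have mem: "l \<in> cyclotomic_coset q n t"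
    unfolding l using finite_cyclotomic_coset[OF assms] ne by (rule Min_in)
  then obtain i where i: "l = t * q ^ i mod n"
    by (auto simp: cyclotomic_coset_def)
  have "l \<le> l * q ^ j mod n" for j
  proof -
    have "l * q ^ j mod n = t * q ^ (i + j) mod n"
      by (simp add: i mod_mult_left_eq power_add mult.assoc)
    then have "l * q ^ j mod n \<in> cyclotomic_coset q n t"
      by (auto simp: cyclotomic_coset_def)
    then show ?thesis
      unfolding l using finite_cyclotomic_coset[OF assms] by (rule Min_le[rotated])
  qed
  moreover have "l < n" using i assms by simp
  ultimately show "l \<in> {t. t < n \<and> (\<forall>j. t \<le> t * q ^ j mod n)}" by simp
next
  fix t assume t: "t \<in> {t. t < n \<and> (\<forall>j. t \<le> t * q ^ j mod n)}"
  have "t = t * q ^ 0 mod n" using t by simp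
  then have "t \<in> cyclotomic_coset q n t"
    unfolding cyclotomic_coset_def by blast
  then have "coset_leader q n t = t"
    unfolding coset_leader_def using t finite_cyclotomic_coset[OF assms]
    by (intro Min_eqI) (auto simp: cyclotomic_coset_def)
  then show "t \<in> coset_leaders q n"
    using t unfolding coset_leaders_def
    by (metis (mono_tags, lifting) atLeastLessThan_iff image_eqI mem_Collect_eq zero_le)
qed

lemma second_largest_eqI:
  assumes "finite S" "a \<in> S" "b \<in> S" "b < a" "\<And>x. x \<in> S \<Longrightarrow> b < x \<Longrightarrow> x = a"
  shows "second_largest S = b"
proof -
  have "x \<le> a" if "x \<in> S" for x
    using assms(4,5) that by (cases "b < x") auto
  with assms have "Max S = a"
    by (intro Max_eqI)
  moreover have "Max (S - {a}) = b"
  proof (rule Max_eqI)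
    show "x \<le> b" if "x \<in> S - {a}" for x
      using assms(5)[of x] that by (cases "b < x") auto
  qed (use assms(1,3,4) in auto)
  ultimately show ?thesis by (simp add: second_largest_def)
qed

lemma card_cyclotomic_coset:
  assumes "n > 0" "m > 0" "[q ^ m = 1] (mod n)"
    and "\<And>j. 0 < j \<Longrightarrow> j < m \<Longrightarrow> \<not> [t * q ^ j = t] (mod n)"
  shows "card (cyclotomic_coset q n t) = m"
proof -
  have "cyclotomic_coset q n t = (\<lambda>j. t * q ^ j mod n) ` {..<m}"
  proof -
    have "t * q ^ j mod n = t * q ^ (j mod m) mod n" for j
    proof -
      have "[(q ^ m) ^ (j div m) = 1 ^ (j div m)] (mod n)"
        using assms(3) by (rule cong_pow)
      then have "[t * ((q ^ m) ^ (j div m) * q ^ (j mod m)) = t * (1 * q ^ (j mod m))] (mod n)"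
        by (intro cong_mult cong_refl) simp
      then show ?thesis
        by (simp add: cong_def flip: power_mult power_add)
    qed
    then show ?thesis
      using \<open>m > 0\<close> unfolding cyclotomic_coset_def
      by (auto simp: image_iff) (metis lessThan_iff mod_less_divisor)
  qed
  moreover have "inj_on (\<lambda>j. t * q ^ j mod n) {..<m}"
  proof (rule linorder_inj_onI')
    fix i j assume ij: "i \<in> {..<m}" "j \<in> {..<m}" "i < j"
    show "t * q ^ i mod n \<noteq> t * q ^ j mod n"
    proof
      assume "t * q ^ i mod n = t * q ^ j mod n"
      \<comment> \<open>Multiplying by \<open>q ^ (m - i)\<close> undoes \<open>q ^ i\<close>,
        because \<open>q ^ m\<close> is 1 modulo \<open>n\<close>; a coincidence thus becomes a
        return to \<open>t\<close> after \<open>j - i\<close> steps.\<close>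
      then have "[t * q ^ i * q ^ (m - i) = t * q ^ j * q ^ (m - i)] (mod n)"
        by (intro cong_mult[OF _ cong_refl]) (simp add: cong_def)
      moreover have "t * q ^ i * q ^ (m - i) = t * q ^ m"
        using ij by (simp add: mult.assoc flip: power_add)
      moreover have "t * q ^ j * q ^ (m - i) = t * q ^ (j - i) * q ^ m"
        using ij by (simp add: mult.assoc flip: power_add)
      moreover have "[t * q ^ m = t * 1] (mod n)"
        using assms(3) by (intro cong_mult cong_refl)
      moreover have "[t * q ^ (j - i) * q ^ m = t * q ^ (j - i) * 1] (mod n)"
        using assms(3) by (intro cong_mult cong_refl)
      ultimately have "[t * q ^ (j - i) = t] (mod n)"
        by (metis cong_def mult.right_neutral)
      moreover have "0 < j - i" "j - i < m" using ij by auto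
      ultimately show False using assms(4) by blast
    qed
  qed
  ultimately show ?thesis by (simp add: card_image)
qed

section \<open>Divisibility by \<open>q + 1\<close>\<close>

text \<open>Modulo \<open>q + 1\<close> the base \<open>q\<close> is -1. For even \<open>a\<close>
  the residue is 2, which is nonzero since \<open>q + 1\<close> is at least 3.\<close>

lemma Suc_dvd_power_add_1_iff:
  fixes q :: nat
  assumes "q \<ge> 2"
  shows "(q + 1) dvd (q ^ a + 1) \<longleftrightarrow> odd a"
proof -
  have "[int q = - 1] (mod int (q + 1))"
    by (simp add: cong_iff_dvd_diff add.commute)
  then have "[int q ^ a + 1 = (- 1) ^ a + 1] (mod int (q + 1))"
    by (intro cong_add cong_pow cong_refl)
  then have "int (q + 1) dvd int (q ^ a + 1) \<longleftrightarrow> int (q + 1) dvd (- 1) ^ a + 1"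
    using cong_dvd_iff by (metis of_nat_1 of_nat_add of_nat_power cong_dvd_iff)
  also have "\<dots> \<longleftrightarrow> odd a"
    using assms by (cases "even a") (auto dest: zdvd_imp_le)
  finally show ?thesis by (simp only: of_nat_dvd_iff)
qed

lemma Suc_dvd_power_add_power_iff:
  fixes q :: nat
  assumes "q \<ge> 2" "k \<le> l"
  shows "(q + 1) dvd (q ^ l + q ^ k) \<longleftrightarrow> odd (l - k)"
proof -
  have "q ^ l + q ^ k = q ^ k * (q ^ (l - k) + 1)"
    using assms(2) by (simp add: distrib_left flip: power_add)
  moreover have "coprime (q + 1) (q ^ k)" by simp
  ultimately show ?thesis
    by (simp only: coprime_dvd_mult_right_iff Suc_dvd_power_add_1_iff[OF assms(1)])
qed

section \<open>Arithmetic modulo \<open>N\<close>\<close>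

locale cyclotomic_modulus =
  fixes q s n N :: nat
  assumes q: "q \<ge> 2" and s: "s \<ge> 1"
    and N_def: "N = q ^ (2 * s) - 1" and N_eq: "N = (q + 1) * n"
begin

lemma power_eq_Suc_N: "q ^ (2 * s) = N + 1"
  using q by (simp add: N_def)

lemma power_step:
  "q * q ^ (2 * s - 2) = q ^ (2 * s - 1)" "q * q ^ (2 * s - 1) = N + 1"
proof -
  have "Suc (2 * s - 2) = 2 * s - 1" "Suc (2 * s - 1) = 2 * s" using s by linarith+
  then show "q * q ^ (2 * s - 2) = q ^ (2 * s - 1)" "q * q ^ (2 * s - 1) = N + 1"
    by (simp_all only: power_Suc[symmetric] power_eq_Suc_N)
qed

lemma N_ge: "N \<ge> 3"
proof -
  have "2 ^ 2 \<le> q ^ 2" using q by (intro power_mono) auto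
  also have "\<dots> \<le> q ^ (2 * s)" using q s by (intro power_increasing) auto
  finally show ?thesis by (simp add: N_def)
qed

lemma n_pos: "n > 0"
  using N_ge N_eq by (cases n) auto

lemma power_cong_1: "[q ^ (2 * s) = 1] (mod N)"
  using N_ge by (simp add: power_eq_Suc_N cong_def mod_Suc)

lemma power_cong_mod: "[q ^ i = q ^ (i mod (2 * s))] (mod N)"
proof -
  have "[(q ^ (2 * s)) ^ (i div (2 * s)) * q ^ (i mod (2 * s)) =
         1 ^ (i div (2 * s)) * q ^ (i mod (2 * s))] (mod N)"
    by (intro cong_mult cong_pow cong_refl power_cong_1)
  then show ?thesis by (simp flip: power_mult power_add)
qed

section \<open>Complements and rotations of words\<close>

text \<open>As \<open>(q + 1) * t\<close> is \<open>- U\<close> modulo \<open>N\<close>, its shifts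
  are the negatives of those of \<open>U\<close>; dividing by \<open>q + 1\<close> turns the modulus
  \<open>N\<close> into \<open>n\<close>. The range of \<open>x\<close> makes \<open>N - x\<close>
  the reduced residue.\<close>

lemma complement_shift:
  assumes "(q + 1) * t + U = N" "[x = U * q ^ j] (mod N)" "0 < x" "x < N"
  shows "(q + 1) * (t * q ^ j mod n) + x = N"
proof -
  have "[(q + 1) * t * q ^ j + x = (q + 1) * t * q ^ j + U * q ^ j] (mod N)"
    using assms(2) by (intro cong_add cong_refl)
  also have "(q + 1) * t * q ^ j + U * q ^ j = N * q ^ j"
    by (simp add: assms(1)[symmetric] algebra_simps)
  also have "[N * q ^ j = (N - x) + x] (mod N)"
    using assms(4) by (simp add: cong_def)
  finally have "[(q + 1) * t * q ^ j = N - x] (mod N)"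
    by (simp only: cong_add_rcancel_nat)
  then have "((q + 1) * (t * q ^ j)) mod N = N - x"
    using assms(3,4) by (simp only: cong_def mult.assoc) simp
  then show ?thesis
    using assms(4) by (simp only: N_eq mod_mult_mult1)
qed

lemma leader_shift_le:
  assumes "(q + 1) * t + U = N" "\<And>j. t \<le> t * q ^ j mod n"
    and "[x = U * q ^ j] (mod N)" "0 < x" "x < N"
  shows "x \<le> U"
proof -
  have "(q + 1) * t \<le> (q + 1) * (t * q ^ j mod n)"
    using assms(2) by (rule mult_le_mono2)
  with complement_shift[OF assms(1,3,4,5)] assms(1) show ?thesis by linarith
qed

text \<open>\<open>A\<close> holds the top \<open>2 * s - r\<close> digits of \<open>U\<close> and
  \<open>B\<close> the low \<open>r\<close>. As \<open>q ^ (2 * s)\<close> is 1 modulo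
  \<open>N\<close>, multiplying by \<open>q ^ (2 * s - r)\<close> swaps the two blocks.\<close>

lemma leader_rotate_le:
  assumes t: "(q + 1) * t + U = N" "\<And>j. t \<le> t * q ^ j mod n"
    and U: "0 < U" "U < N" "U = A * q ^ r + B"
    and r: "r \<le> 2 * s" "B < q ^ r" "A < q ^ (2 * s - r)"
  shows "B * q ^ (2 * s - r) + A \<le> U"
proof (rule leader_shift_le[OF t])
  let ?m = "2 * s" and ?x = "B * q ^ (2 * s - r) + A"
  have split: "q ^ r * q ^ (?m - r) = N + 1"
    using r(1) by (simp add: power_eq_Suc_N flip: power_add)
  have "U * q ^ (?m - r) = A * (q ^ r * q ^ (?m - r)) + B * q ^ (?m - r)"
    by (simp add: U(3) algebra_simps)
  also have "\<dots> = A * N + ?x" by (simp add: split)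
  finally show "[?x = U * q ^ (?m - r)] (mod N)" by (simp add: cong_def)
  show "0 < ?x" using U q by auto
  have "(B + 1) * q ^ (?m - r) \<le> q ^ r * q ^ (?m - r)"
    using r(2) by (intro mult_le_mono1) simp
  then have le: "?x \<le> N" using r(3) by (simp add: split)
  \<comment> \<open>\<open>N\<close> has all digits equal to \<open>q - 1\<close>, a word fixed by
    rotation, so \<open>?x = N\<close> would force \<open>U = N\<close>.\<close>
  have "?x \<noteq> N"
  proof
    assume eq: "?x = N"
    have "B + 1 = q ^ r"
    proof (rule ccontr)
      assume "B + 1 \<noteq> q ^ r"
      with r(2) have "(B + 2) * q ^ (?m - r) \<le> q ^ r * q ^ (?m - r)"
        by (intro mult_le_mono1) simp
      then show False using r(3) eq by (simp add: split)
    qed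
    then have "A + 1 = q ^ (?m - r)"
      using eq split by (metis add.assoc add.commute add_left_cancel add_mult_distrib mult_1)
    with \<open>B + 1 = q ^ r\<close> have "U + 1 = q ^ r * q ^ (?m - r)"
      unfolding U(3) by (metis add.assoc add_mult_distrib mult.commute mult_1)
    with split U(2) show False by simp
  qed
  with le show "?x < N" by simp
qed

section \<open>Classification of the small words\<close>

text \<open>Each nonzero digit is rotated to the top in turn; dominance and the upper bound on
  \<open>U\<close> limit what may follow it. The bound \<open>s - 1 \<le> k\<close> says that the
  zeros after the leading one are no more numerous than those after the second one.\<close>

lemma small_complement:
  assumes t: "(q + 1) * t + U = N" "\<And>j. t \<le> t * q ^ j mod n"
    and U: "0 < U" "U < N" "U < q ^ (2 * s - 1) + q ^ e"
    and e: "e + 2 \<le> 2 * s" "3 * e < 4 * s"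
  obtains k where "U = q ^ (2 * s - 1) + q ^ k" "even k" "s - 1 \<le> k" "k < e"
proof -
  let ?m = "2 * s"
  note rotate = leader_rotate_le[OF t U(1,2)]
  have q1: "1 < q" using q by simp
  have pw: "q ^ i * q ^ j = q ^ h" if "i + j = h" for i j h
    using that by (simp flip: power_add)
  have "(q + 1) dvd U"
    using t(1) N_eq by (metis dvd_add_right_iff dvd_triv_left)
  \<comment> \<open>A leading zero could be rotated to the end, multiplying \<open>U\<close> by
    \<open>q\<close>.\<close>
  have "q ^ (?m - 1) \<le> U"
  proof (rule ccontr)
    assume "\<not> q ^ (?m - 1) \<le> U"
    then have "U * q \<le> U"
      using rotate[of 0 "?m - 1" U] s q by simp
    then show False using U(1) q by simp
  qed
  then obtain V where V: "U = q ^ (?m - 1) + V" "V < q ^ e"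
    using U(3) by (metis le_Suc_ex nat_add_left_cancel_less)
  have "V > 0"
  proof (rule ccontr)
    assume "\<not> V > 0"
    then have "(q + 1) dvd q ^ (?m - 1)" using \<open>(q + 1) dvd U\<close> V by simp
    moreover have "coprime (q + 1) (q ^ (?m - 1))" by simp
    ultimately have "is_unit (q + 1)" using coprime_absorb_left by blast
    then show False using q by (simp only: nat_dvd_1_iff_1)
  qed
  then obtain k where k: "q ^ k \<le> V" "V < q ^ (k + 1)"
    using ex_power_ivl1[of q V] q by auto
  have ke: "k < e"
    using k(1) V(2) power_less_imp_less_exp[OF q1] by (meson le_less_trans)
  \<comment> \<open>This rotation brings position \<open>k\<close>, the leading digit of
    \<open>V\<close>, to the top.\<close>
  have "V * q ^ (?m - (k + 1)) + q ^ (?m - 2 - k) \<le> U"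
  proof (rule rotate)
    have "q ^ (?m - 2 - k) * q ^ (k + 1) = q ^ (?m - 1)" using ke e by (intro pw) linarith
    then show "U = q ^ (?m - 2 - k) * q ^ (k + 1) + V" by (simp only: V(1))
    show "q ^ (?m - 2 - k) < q ^ (?m - (k + 1))"
      using ke e by (intro power_strict_increasing q1) linarith
  qed (use k ke e in auto)
  \<comment> \<open>\<open>W\<close> may still contribute to position \<open>k\<close>; that the
    digit there is 1 follows only from \<open>VW\<close>.\<close>
  obtain W where W: "V = q ^ k + W" using k(1) le_Suc_ex by blast
  have VW: "W * q ^ (?m - 1 - k) + q ^ (?m - 2 - k) < q ^ e"
  proof -
    have "V * q ^ (?m - (k + 1)) = q ^ (?m - 1) + W * q ^ (?m - 1 - k)"
    proof -
      have "q ^ k * q ^ (?m - (k + 1)) = q ^ (?m - 1)" using ke e by (intro pw) linarith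
      then show ?thesis by (simp add: W distrib_right)
    qed
    with \<open>V * q ^ (?m - (k + 1)) + q ^ (?m - 2 - k) \<le> U\<close> U(3) show ?thesis by linarith
  qed
  have "W = 0"
  proof (rule ccontr)
    assume "W \<noteq> 0"
    then obtain l where l: "q ^ l \<le> W" "W < q ^ (l + 1)"
      using ex_power_ivl1[of q W] q by auto
    have "q ^ l * q ^ (?m - 1 - k) \<le> W * q ^ (?m - 1 - k)"
      using l(1) by (rule mult_le_mono1)
    then have "q ^ (l + (?m - 1 - k)) < q ^ e" using VW unfolding power_add by linarith
    then have l1: "l + (?m - 1 - k) < e" by (rule power_less_imp_less_exp[OF q1])
    \<comment> \<open>Now a third nonzero digit, at position \<open>l\<close>, is rotated to the
      top.\<close>
    have "W * q ^ (?m - (l + 1)) + (q ^ (?m - 2 - l) + q ^ (k - 1 - l)) \<le> U"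
    proof (rule rotate)
      have lk: "l + 1 \<le> k" using l1 ke e by linarith
      show "U = (q ^ (?m - 2 - l) + q ^ (k - 1 - l)) * q ^ (l + 1) + W"
      proof -
        have "q ^ (?m - 2 - l) * q ^ (l + 1) = q ^ (?m - 1)" "q ^ (k - 1 - l) * q ^ (l + 1) = q ^ k"
          using lk ke e by (intro pw; linarith)+
        then show ?thesis by (simp only: V(1) W distrib_right add.assoc)
      qed
      have "q ^ (k - 1 - l) < q ^ (?m - 2 - l)"
        using lk ke e q1 by (intro power_strict_increasing) auto
      then have "q ^ (?m - 2 - l) + q ^ (k - 1 - l) < 2 * q ^ (?m - 2 - l)" by simp
      also have "\<dots> \<le> q * q ^ (?m - 2 - l)" using q by (rule mult_le_mono1)
      also have "\<dots> = q ^ (?m - (l + 1))"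
        using pw[of 1 "?m - 2 - l" "?m - (l + 1)"] lk ke e by simp
      finally show "q ^ (?m - 2 - l) + q ^ (k - 1 - l) < q ^ (?m - (l + 1))" .
    qed (use l l1 ke e in auto)
    moreover have "q ^ (?m - 1) \<le> W * q ^ (?m - (l + 1))"
    proof -
      have "q ^ l * q ^ (?m - (l + 1)) \<le> W * q ^ (?m - (l + 1))"
        using l(1) by (rule mult_le_mono1)
      moreover have "q ^ l * q ^ (?m - (l + 1)) = q ^ (?m - 1)"
        using l1 ke e by (intro pw) linarith
      ultimately show ?thesis by (simp only:)
    qed
    ultimately have "q ^ (?m - 2 - l) < q ^ e" using U(3) by linarith
    then have "?m - 2 - l < e" by (rule power_less_imp_less_exp[OF q1])
    \<comment> \<open>The bounds \<open>l + ?m - k \<le> e\<close>,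
      \<open>?m - 1 \<le> e + l\<close> and \<open>k + 1 \<le> e\<close> add up to
      \<open>4 * s \<le> 3 * e\<close>.\<close>
    with l1 ke e show False by linarith
  qed
  have U_eq: "U = q ^ (?m - 1) + q ^ k" using V W \<open>W = 0\<close> by simp
  have "odd (?m - 1 - k)"
    using \<open>(q + 1) dvd U\<close> ke e unfolding U_eq
    by (subst (asm) Suc_dvd_power_add_power_iff[OF q]) auto
  then have "even k" using ke e by (auto simp: even_diff_nat split: if_splits)
  have "q ^ k * q ^ (?m - (k + 1)) = q ^ (?m - 1)"
    using ke e by (intro pw) linarith
  then have "q ^ (?m - 2 - k) \<le> q ^ k"
    using \<open>V * q ^ (?m - (k + 1)) + q ^ (?m - 2 - k) \<le> U\<close> U_eq W \<open>W = 0\<close> by simp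
  then have "?m - 2 - k \<le> k" using power_le_imp_le_exp[OF q1] by blast
  then have "s - 1 \<le> k" by linarith
  with that U_eq \<open>even k\<close> ke show thesis by blast
qed

section \<open>Words with two ones\<close>

text \<open>Only rotations with a one on top compete, and there the shorter run of zeros should come
  first. A nontrivial tie needs both runs to have equal length, that is
  \<open>k = s - 1\<close>.\<close>

lemma two_digit_shift:
  assumes "k < 2 * s - 1" "s - 1 \<le> k"
  obtains x where "[x = (q ^ (2 * s - 1) + q ^ k) * q ^ j] (mod N)" "0 < x"
    "x \<le> q ^ (2 * s - 1) + q ^ k"
    "x = q ^ (2 * s - 1) + q ^ k \<Longrightarrow> j mod (2 * s) \<noteq> 0 \<Longrightarrow> k = s - 1"
proof -
  let ?m = "2 * s" and ?U = "q ^ (2 * s - 1) + q ^ k"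
  define i where "i = j mod ?m"
  define a b where "a = (?m - 1 + i) mod ?m" and "b = (k + i) mod ?m"
  have q1: "1 < q" using q by simp
  have i_less: "i < ?m" using s by (simp add: i_def)
  have "[q ^ a + q ^ b = q ^ (?m - 1 + j) + q ^ (k + j)] (mod N)"
    unfolding a_def b_def i_def mod_add_right_eq
    by (intro cong_add cong_sym[OF power_cong_mod])
  also have "q ^ (?m - 1 + j) + q ^ (k + j) = ?U * q ^ j"
    by (simp add: power_add algebra_simps)
  finally have cong: "[q ^ a + q ^ b = ?U * q ^ j] (mod N)" .
  have "q ^ a + q ^ b \<le> ?U \<and> (q ^ a + q ^ b = ?U \<longrightarrow> i \<noteq> 0 \<longrightarrow> k = s - 1)"
  proof (cases "i = 0")
    case True
    then have "a = ?m - 1" "b = k" using assms s by (auto simp: a_def b_def)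
    with True show ?thesis by simp
  next
    case False
    have "?m - 1 + i = (i - 1) + ?m" using False s by simp
    then have "a = (i - 1) mod ?m" unfolding a_def by (metis mod_add_self2)
    then have a: "a = i - 1" using i_less by simp
    show ?thesis
    \<comment> \<open>This shift moves the lower one to the top. Any other nonzero shift leaves the
      top digit zero, so the sum is at most \<open>2 * q ^ (?m - 2)\<close>, hence at most
      \<open>q ^ (?m - 1)\<close>.\<close>
    proof (cases "i = ?m - 1 - k")
      case True
      then have "b = ?m - 1" using assms s by (simp add: b_def)
      moreover have "a = ?m - 2 - k" using a True by simp
      moreover have "q ^ (?m - 2 - k) \<le> q ^ k"
        using assms q by (intro power_increasing) auto
      moreover have "k = s - 1" if "q ^ (?m - 2 - k) = q ^ k"
      proof -
        have "?m - 2 - k = k" using that power_inject_exp[OF q1] by blast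
        then show ?thesis using assms by linarith
      qed
      ultimately show ?thesis by auto
    next
      case False
      have "b \<noteq> ?m - 1"
      proof
        assume b: "b = ?m - 1"
        show False
        proof (cases "k + i < ?m")
          case True
          then have "b = k + i" by (simp add: b_def)
          with b False show False by simp
        next
          case ge: False
          then have "b = k + i - ?m"
            using assms i_less by (simp add: b_def mod_if)
          with b ge assms i_less show False by linarith
        qed
      qed
      moreover have "b < ?m" using s by (simp add: b_def)
      ultimately have "b \<le> ?m - 2" by linarith
      then have "q ^ b \<le> q ^ (?m - 2)" using q by (intro power_increasing) auto
      moreover have "q ^ a \<le> q ^ (?m - 2)"
        using q a i_less by (intro power_increasing) auto
      moreover have "2 * q ^ (?m - 2) \<le> q * q ^ (?m - 2)"
        using q by (rule mult_le_mono1)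
      moreover have "q * q ^ (?m - 2) = q ^ (?m - 1)"
        by (rule power_step)
      moreover have "0 < q ^ k" using q by simp
      ultimately show ?thesis by linarith
    qed
  qed
  with that[OF cong] q show thesis by (simp add: i_def)
qed

text \<open>The bound on \<open>s\<close> excludes \<open>q = 2\<close>, \<open>s = 1\<close>,
  \<open>k = 0\<close>, where the word equals \<open>N\<close>.\<close>

lemma two_digit_less:
  assumes "k < 2 * s - 1" "s \<ge> 2"
  shows "q ^ (2 * s - 1) + q ^ k < N"
proof -
  have "q ^ 1 \<le> q ^ (2 * s - 2)"
    using assms q by (intro power_increasing) auto
  then have "2 \<le> q ^ (2 * s - 2)" using q by simp
  moreover have "2 * q ^ (2 * s - 2) \<le> q ^ (2 * s - 1)" "2 * q ^ (2 * s - 1) \<le> N + 1"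
    unfolding power_step[symmetric] using q by (rule mult_le_mono1)+
  ultimately have "q ^ (2 * s - 1) + q ^ (2 * s - 2) < N" by linarith
  moreover have "q ^ k \<le> q ^ (2 * s - 2)"
    using assms q by (intro power_increasing) auto
  ultimately show ?thesis by (meson add_left_mono le_less_trans)
qed

lemma two_digit_complement:
  assumes "k < 2 * s - 1" "even k" "s \<ge> 2"
  obtains t where "(q + 1) * t + (q ^ (2 * s - 1) + q ^ k) = N" "t < n"
proof -
  let ?U = "q ^ (2 * s - 1) + q ^ k"
  have le: "?U < N" using assms by (intro two_digit_less)
  have "(q + 1) dvd ?U"
    using assms by (subst Suc_dvd_power_add_power_iff[OF q]) auto
  moreover have "(q + 1) dvd N" unfolding N_eq by (rule dvd_triv_left)
  ultimately have "(q + 1) dvd N - ?U" by (rule dvd_diff_nat[rotated])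
  then obtain t where t: "N - ?U = (q + 1) * t" by (elim dvdE)
  with le have eq: "(q + 1) * t + ?U = N" by simp
  have "0 < ?U" using q by simp
  with eq have "(q + 1) * t < (q + 1) * n" unfolding N_eq by linarith
  then have "t < n" unfolding mult_less_cancel1 by blast
  with that eq show thesis by blast
qed

text \<open>The first claim yields leaders; the second shows that unequal runs of zeros give a coset
  of full size.\<close>

lemma two_digit_leader:
  assumes "(q + 1) * t + (q ^ (2 * s - 1) + q ^ k) = N"
    and k: "k < 2 * s - 1" "s - 1 \<le> k" and "s \<ge> 2"
  shows "t \<le> t * q ^ j mod n"
    and "t * q ^ j mod n = t \<Longrightarrow> j mod (2 * s) \<noteq> 0 \<Longrightarrow> k = s - 1"
proof -
  obtain x where x: "[x = (q ^ (2 * s - 1) + q ^ k) * q ^ j] (mod N)" "0 < x"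
    "x \<le> q ^ (2 * s - 1) + q ^ k"
    "x = q ^ (2 * s - 1) + q ^ k \<Longrightarrow> j mod (2 * s) \<noteq> 0 \<Longrightarrow> k = s - 1"
    using two_digit_shift[OF k, of j] by blast
  have "x < N" using two_digit_less[OF k(1) assms(4)] x(3) by linarith
  with assms(1) x(1,2) have eq: "(q + 1) * (t * q ^ j mod n) + x = N"
    by (intro complement_shift)
  with assms(1) x(3) have "(q + 1) * t \<le> (q + 1) * (t * q ^ j mod n)" by linarith
  then show "t \<le> t * q ^ j mod n" unfolding mult_le_cancel1 by simp
  show "k = s - 1" if "t * q ^ j mod n = t" "j mod (2 * s) \<noteq> 0"
    using x(4) that eq assms(1) by simp
qed

section \<open>The two largest leaders\<close>

lemma delta2_and_coset_size:
  assumes e: "even e" "s + 1 \<le> e" "e \<le> s + 2" "3 * e < 4 * s"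
  shows "(q + 1) * delta2 q n + (q ^ (2 * s - 1) + q ^ e) = N"
    and "card (cyclotomic_coset q n (delta2 q n)) = 2 * s"
proof -
  have s2: "s \<ge> 2" and e2: "e < 2 * s - 1" "e - 2 < 2 * s - 1" and e3: "s - 1 \<le> e - 2"
    using e by linarith+
  obtain a where a: "(q + 1) * a + (q ^ (2 * s - 1) + q ^ (e - 2)) = N" "a < n"
    using two_digit_complement[of "e - 2"] e e2 s2 by auto
  obtain b where b: "(q + 1) * b + (q ^ (2 * s - 1) + q ^ e) = N" "b < n"
    using two_digit_complement[of e] e e2 s2 by auto
  have "second_largest (coset_leaders q n) = b"
  proof (rule second_largest_eqI)
    show "a \<in> coset_leaders q n"
      using a two_digit_leader(1)[OF a(1)] e2 e3 s2 by (simp add: coset_leaders_eq[OF n_pos])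
    show "b \<in> coset_leaders q n"
      using b two_digit_leader(1)[OF b(1)] e e2 s2 by (simp add: coset_leaders_eq[OF n_pos])
    have "q ^ (e - 2) < q ^ e"
      using q e by (intro power_strict_increasing) auto
    then have "(q + 1) * b < (q + 1) * a" using a(1) b(1) by linarith
    then show "b < a" unfolding mult_less_cancel1 by blast
  next
    fix t assume "t \<in> coset_leaders q n" and "b < t"
    then have t: "t < n" "\<And>j. t \<le> t * q ^ j mod n"
      by (auto simp: coset_leaders_eq[OF n_pos])
    have "(q + 1) * t < (q + 1) * n" using t(1) unfolding mult_less_cancel1 by simp
    then obtain U where U: "(q + 1) * t + U = N" "0 < U"
      unfolding N_eq by (metis less_imp_add_positive)
    have "(q + 1) * b < (q + 1) * t" using \<open>b < t\<close> unfolding mult_less_cancel1 by simp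
    \<comment> \<open>\<open>U < N\<close> holds because \<open>b < t\<close> makes \<open>t\<close>
      nonzero.\<close>
    with U(1) b(1) have "U < q ^ (2 * s - 1) + q ^ e" and "U < N" by linarith+
    then obtain k where k: "U = q ^ (2 * s - 1) + q ^ k" "even k" "s - 1 \<le> k" "k < e"
      using small_complement[OF U(1) t(2) U(2)] e by auto
    obtain c d where cd: "e = 2 * c" "k = 2 * d" using e(1) k(2) by (elim evenE)
    with k(3,4) e(3) have "d < c" "c < d + 2" by linarith+
    \<comment> \<open>As \<open>e - 4 < s - 1\<close>, the only even number from
      \<open>s - 1\<close> up to below \<open>e\<close> is \<open>e - 2\<close>.\<close>
    then have "k = e - 2" by (simp add: cd)
    then have "(q + 1) * t = (q + 1) * a"
      using a(1) U(1) k(1) by (metis add_right_cancel)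
    then show "t = a" using mult_left_cancel[of "q + 1" t a] by simp
  qed (rule finite_coset_leaders)
  then have b_eq: "delta2 q n = b" by (simp add: delta2_def)
  show "(q + 1) * delta2 q n + (q ^ (2 * s - 1) + q ^ e) = N"
    using b(1) by (simp add: b_eq)
  show "card (cyclotomic_coset q n (delta2 q n)) = 2 * s"
    unfolding b_eq
  proof (rule card_cyclotomic_coset[OF n_pos])
    show "[q ^ (2 * s) = 1] (mod n)"
      by (rule cong_dvd_modulus_nat[OF power_cong_1]) (simp only: N_eq dvd_triv_right)
    show "\<not> [b * q ^ j = b] (mod n)" if "0 < j" "j < 2 * s" for j
    proof
      assume "[b * q ^ j = b] (mod n)"
      with b(2) have "b * q ^ j mod n = b" by (simp add: cong_def)
      with two_digit_leader(2)[OF b(1) e2(1) _ s2, of j] that e(2) have "e = s - 1" by simp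
      with e(2) show False by simp
    qed
  qed (use s in simp)
qed

lemma real_delta2:
  assumes "(q + 1) * d + (q ^ (2 * s - 1) + q ^ e) = N"
  shows "real d = ((real q - 1) * real q ^ (2 * s - 1) - real q ^ e - 1) / (real q + 1)"
proof -
  have "real ((q + 1) * d + (q ^ (2 * s - 1) + q ^ e) + 1) = real (q ^ (2 * s))"
    by (simp only: assms power_eq_Suc_N)
  moreover have "real q ^ (2 * s) = real q * real q ^ (2 * s - 1)"
    using s by (simp flip: power_Suc)
  ultimately have "(real q + 1) * real d = (real q - 1) * real q ^ (2 * s - 1) - real q ^ e - 1"
    by (simp add: algebra_simps)
  moreover have "real q + 1 \<noteq> 0" by linarith
  ultimately show ?thesis by (simp add: nonzero_eq_divide_eq mult.commute)
qed

end

theorem lemma16: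
  fixes q s n :: nat
  assumes "primepow q"
    and "s > 0"
    and "n = (q ^ (2 * s) - 1) div (q + 1)"
  shows "(odd s \<and> s > 4 \<longrightarrow>
            real (delta2 q n) =
              ((real q - 1) * real q ^ (2 * s - 1) - real q ^ (s + 1) - 1) / (real q + 1) \<and>
            card (cyclotomic_coset q n (delta2 q n)) = 2 * s) \<and>
         (even s \<and> s > 6 \<longrightarrow>
            real (delta2 q n) =
              ((real q - 1) * real q ^ (2 * s - 1) - real q ^ (s + 2) - 1) / (real q + 1) \<and>
            card (cyclotomic_coset q n (delta2 q n)) = 2 * s)"
proof -
  have "q ^ (2 * s) - 1 = (q + 1) * n"
    using Suc_dvd_power_even_minus_1[of q s] by (simp only: assms(3) dvd_mult_div_cancel)
  then interpret cyclotomic_modulus q s n "q ^ (2 * s) - 1"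
    using primepow_gt_Suc_0[OF assms(1)] assms(2) by unfold_locales auto
  have "real (delta2 q n) =
          ((real q - 1) * real q ^ (2 * s - 1) - real q ^ e - 1) / (real q + 1) \<and>
        card (cyclotomic_coset q n (delta2 q n)) = 2 * s"
    if "even e" "s + 1 \<le> e" "e \<le> s + 2" "3 * e < 4 * s" for e
    using delta2_and_coset_size[OF that] real_delta2 by blast
  \<comment> \<open>The condition \<open>3 * e < 4 * s\<close> reads \<open>s > 3\<close> for
    \<open>e = s + 1\<close> and \<open>s > 6\<close> for \<open>e = s + 2\<close>.\<close>
  from this[of "s + 1"] this[of "s + 2"] show ?thesis by auto
qed

end
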